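(* Let $A\in\mathcal A$ with $\mu(A)>0$, let $r>0$ and let $g\in L_p(S;X)$. Then the metric projection $P_{C_A(r)}:L_p(S;X)\to C_A(r)$ satisfies: (a) $P_{C_A(r)}(g)=g$, for $g\in C_A(r)$; (b) $P_{C_A(r)}(g)=\dfrac{r}{\|g_A\|_{L_p(A;X)}}\,g_A+g_{S\setminus A}$, for $g\in L_p(S;X)\setminus C_A(r)$.
   Context: Let $(S,\mathcal A,\mu)$ be a positive measure space, $X$ a real uniformly convex and uniformly smooth Banach space, and $1<p<\infty$. $L_p(S;X)$ is the Bochner space of ($\mu$-equivalence classes of) strongly measurable $f:S\to X$ with $\|f\|_{L_p(S;X)}=\left(\int_S\|f(s)\|_X^p\,d\mu(s)\right)^{1/p}<\infty$; it is a uniformly convex and uniformly smooth Banach space. For $A\in\mathcal A$ with $\mu(A)>0$, $L_p(A;X)$ is the subspace $\{f\in L_p(S;X): f(s)=\theta \text{ for } \mu\text{-a.e. } s\in S\setminus A\}$ ($\theta$ denotes the zero vector) with the induced norm, denoted $\|\cdot\|_{L_p(A;X)}$. For $E\in\mathcal A$ and $f\in L_p(S;X)$, $f_E$ is defined by $f_E(s)=f(s)$ for $s\in E$ and $f_E(s)=\theta$ for $s\notin E$. For $r>0$, $C_A(r)=\{f\in L_p(S;X):\|f_A\|_{L_p(A;X)}\le r\}$, a closed convex set (a cylinder). For a nonempty closed convex subset $C$ of a uniformly convex and uniformly smooth Banach space $Z$, the metric projection $P_C:Z\to C$ assigns to $x$ the unique point $P_Cx\in C$ with $\|x-P_Cx\|\le\|x-z\|$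 for all $z\in C$. *)

theory Defs
  imports "HOL-Analysis.Analysis"
begin

section \<open>Geometry of the target space\<close>

text \<open>Clarkson's definition.\<close>

definition uniformly_convex :: "'x::real_normed_vector itself \<Rightarrow> bool" where
  "uniformly_convex _ \<longleftrightarrow>
    (\<forall>\<epsilon>>0. \<exists>\<delta>>0. \<forall>x y :: 'x.
       norm x = 1 \<longrightarrow> norm y = 1 \<longrightarrow> norm (x - y) \<ge> \<epsilon> \<longrightarrow> norm ((1 / 2) *\<^sub>R (x + y)) \<le> 1 - \<delta>)"

text \<open>
  With the modulus of smoothness
  \<open>\<rho> t = sup {(\<parallel>x + y\<parallel> + \<parallel>x - y\<parallel>) / 2 - 1 | \<parallel>x\<parallel> = 1, \<parallel>y\<parallel> = t}\<close>
  this spells out \<open>\<rho> t / t \<longlonglongrightarrow> 0\<close> as \<open>t\<close> tends to \<open>0\<close> from the right,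
  without taking suprema that would be over the empty set for the zero space.
\<close>

definition uniformly_smooth :: "'x::real_normed_vector itself \<Rightarrow> bool" where
  "uniformly_smooth _ \<longleftrightarrow>
    (\<forall>\<epsilon>>0. \<exists>\<delta>>0. \<forall>x y :: 'x.
       norm x = 1 \<longrightarrow> 0 < norm y \<longrightarrow> norm y < \<delta> \<longrightarrow>
       (norm (x + y) + norm (x - y)) / 2 - 1 \<le> \<epsilon> * norm y)"


section \<open>Bochner spaces\<close>

text \<open>
  Borel measurability is not sufficient for the Bochner theory when \<open>'x\<close> is not separable, so
  strong measurability is required. The approximating simple functions may have supports of
  infinite measure; for functions with integrable \<open>p\<close>-th power of the norm this makes no
  difference, as such a function vanishes off a countable union of sets of finite measure.
\<close>

definition strongly_measurable :: "'s measure \<Rightarrow> ('s \<Rightarrow> 'x::real_normed_vector) \<Rightarrow> bool" where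
  "strongly_measurable M f \<longleftrightarrow>
    (\<exists>h. (\<forall>i. simple_function M (h i)) \<and> (\<forall>s\<in>space M. (\<lambda>i. h i s) \<longlonglongrightarrow> f s))"

definition Lp_fun :: "real \<Rightarrow> 's measure \<Rightarrow> ('s \<Rightarrow> 'x::real_normed_vector) set" where
  "Lp_fun p M = {f. strongly_measurable M f \<and> integrable M (\<lambda>s. norm (f s) powr p)}"

definition Lp_rel ::
    "real \<Rightarrow> 's measure \<Rightarrow> (('s \<Rightarrow> 'x::real_normed_vector) \<times> ('s \<Rightarrow> 'x)) set" where
  "Lp_rel p M = {(f, g). f \<in> Lp_fun p M \<and> g \<in> Lp_fun p M \<and> (AE s in M. f s = g s)}"

text \<open>
  Elements of \<open>Lp p M\<close> are equivalence classes, i.e. sets of functions. The operations on them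
  are lifted from representatives in the style of \<^theory>\<open>HOL.Equiv_Relations\<close>; their independence
  of the representatives is recorded below.
\<close>

definition Lp :: "real \<Rightarrow> 's measure \<Rightarrow> ('s \<Rightarrow> 'x::real_normed_vector) set set" where
  "Lp p M = Lp_fun p M // Lp_rel p M"

definition Lp_norm :: "real \<Rightarrow> 's measure \<Rightarrow> ('s \<Rightarrow> 'x::real_normed_vector) set \<Rightarrow> real" where
  "Lp_norm p M u = the_elem ((\<lambda>f. (\<integral>s. norm (f s) powr p \<partial>M) powr (1 / p)) ` u)"

definition Lp_add ::
    "real \<Rightarrow> 's measure \<Rightarrow> ('s \<Rightarrow> 'x::real_normed_vector) set \<Rightarrow> ('s \<Rightarrow> 'x) set \<Rightarrow> ('s \<Rightarrow> 'x) set" where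
  "Lp_add p M u v = (\<Union>f\<in>u. \<Union>g\<in>v. Lp_rel p M `` {\<lambda>s. f s + g s})"

definition Lp_scale ::
    "real \<Rightarrow> 's measure \<Rightarrow> real \<Rightarrow> ('s \<Rightarrow> 'x::real_normed_vector) set \<Rightarrow> ('s \<Rightarrow> 'x) set" where
  "Lp_scale p M c u = (\<Union>f\<in>u. Lp_rel p M `` {\<lambda>s. c *\<^sub>R f s})"

text \<open>The class \<open>f\<^sub>E\<close>.\<close>

definition Lp_restrict ::
    "real \<Rightarrow> 's measure \<Rightarrow> 's set \<Rightarrow> ('s \<Rightarrow> 'x::real_normed_vector) set \<Rightarrow> ('s \<Rightarrow> 'x) set" where
  "Lp_restrict p M E u = (\<Union>f\<in>u. Lp_rel p M `` {\<lambda>s. if s \<in> E then f s else 0})"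

definition Lp_dist ::
    "real \<Rightarrow> 's measure \<Rightarrow> ('s \<Rightarrow> 'x::real_normed_vector) set \<Rightarrow> ('s \<Rightarrow> 'x) set \<Rightarrow> real" where
  "Lp_dist p M u v = Lp_norm p M (Lp_add p M u (Lp_scale p M (- 1) v))"

text \<open>The subspace \<open>L\<^sub>p(A; X)\<close>. Its norm is induced, so it is \<^const>\<open>Lp_norm\<close> again.\<close>

definition Lp_on :: "real \<Rightarrow> 's measure \<Rightarrow> 's set \<Rightarrow> ('s \<Rightarrow> 'x::real_normed_vector) set set" where
  "Lp_on p M A = {u \<in> Lp p M. \<forall>f\<in>u. AE s in M. s \<notin> A \<longrightarrow> f s = 0}"

definition cylinder ::
    "real \<Rightarrow> 's measure \<Rightarrow> 's set \<Rightarrow> real \<Rightarrow> ('s \<Rightarrow> 'x::real_normed_vector) set set" where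
  "cylinder p M A r = {u \<in> Lp p M. Lp_norm p M (Lp_restrict p M A u) \<le> r}"


section \<open>Metric projection\<close>

text \<open>
  The Bochner spaces are not types, so \<open>closest_point\<close> from the library is not applicable;
  the metric \<open>d\<close> is passed explicitly.
\<close>

definition nearest_point :: "('z \<Rightarrow> 'z \<Rightarrow> real) \<Rightarrow> 'z set \<Rightarrow> 'z \<Rightarrow> 'z \<Rightarrow> bool" where
  "nearest_point d C x y \<longleftrightarrow> y \<in> C \<and> (\<forall>z\<in>C. d x y \<le> d x z)"

definition metric_projection :: "('z \<Rightarrow> 'z \<Rightarrow> real) \<Rightarrow> 'z set \<Rightarrow> 'z \<Rightarrow> 'z" where
  "metric_projection d C x = (THE y. nearest_point d C x y)"


section \<open>Independence of representatives\<close>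

lemma strongly_measurable_norm:
  assumes "strongly_measurable M f"
  shows "(\<lambda>s. norm (f s)) \<in> borel_measurable M"
proof -
  obtain h where h: "\<And>i. simple_function M (h i)" "\<And>s. s \<in> space M \<Longrightarrow> (\<lambda>i. h i s) \<longlonglongrightarrow> f s"
    using assms unfolding strongly_measurable_def by blast
  have "(\<lambda>s. norm (h i s)) \<in> borel_measurable M" for i
    using simple_function_compose1[OF h(1)] by (rule borel_measurable_simple_function)
  then show ?thesis
    by (rule borel_measurable_LIMSEQ_real[where u = "\<lambda>i s. norm (h i s)", rotated])
      (intro tendsto_norm h(2))
qed

lemma strongly_measurable_add:
  assumes "strongly_measurable M f" "strongly_measurable M g"
  shows "strongly_measurable M (\<lambda>s. f s + g s)"
proof -
  obtain h where h: "\<And>i. simple_function M (h i)" "\<And>s. s \<in> space M \<Longrightarrow> (\<lambda>i. h i s) \<longlonglongrightarrow> f s"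
    using assms(1) unfolding strongly_measurable_def by blast
  obtain k where k: "\<And>i. simple_function M (k i)" "\<And>s. s \<in> space M \<Longrightarrow> (\<lambda>i. k i s) \<longlonglongrightarrow> g s"
    using assms(2) unfolding strongly_measurable_def by blast
  have "simple_function M (\<lambda>s. h i s + k i s)" for i
    by (intro simple_function_add h k)
  moreover have "(\<lambda>i. h i s + k i s) \<longlonglongrightarrow> f s + g s" if "s \<in> space M" for s
    using h(2)[OF that] k(2)[OF that] by (rule tendsto_add)
  ultimately show ?thesis
    unfolding strongly_measurable_def by (intro exI[of _ "\<lambda>i s. h i s + k i s"]) simp
qed

lemma strongly_measurable_scale:
  assumes "strongly_measurable M f"
  shows "strongly_measurable M (\<lambda>s. c *\<^sub>R f s)"
proof -
  obtain h where h: "\<And>i. simple_function M (h i)" "\<And>s. s \<in> space M \<Longrightarrow> (\<lambda>i. h i s) \<longlonglongrightarrow> f s"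
    using assms unfolding strongly_measurable_def by blast
  have "simple_function M (\<lambda>s. c *\<^sub>R h i s)" for i
    by (rule simple_function_compose1[OF h(1)])
  moreover have "(\<lambda>i. c *\<^sub>R h i s) \<longlonglongrightarrow> c *\<^sub>R f s" if "s \<in> space M" for s
    using tendsto_const h(2)[OF that] by (rule tendsto_scaleR)
  ultimately show ?thesis
    unfolding strongly_measurable_def by (intro exI[of _ "\<lambda>i s. c *\<^sub>R h i s"]) simp
qed

lemma strongly_measurable_restrict:
  assumes "strongly_measurable M f" "E \<in> sets M"
  shows "strongly_measurable M (\<lambda>s. if s \<in> E then f s else 0)"
proof -
  obtain h where h: "\<And>i. simple_function M (h i)" "\<And>s. s \<in> space M \<Longrightarrow> (\<lambda>i. h i s) \<longlonglongrightarrow> f s"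
    using assms unfolding strongly_measurable_def by blast
  have "E \<inter> space M \<in> sets M"
    using assms(2) by auto
  then have "simple_function M (\<lambda>s. if s \<in> E then h i s else 0)" for i
    by (intro simple_function_If_set h simple_function_const)
  moreover have "(\<lambda>i. if s \<in> E then h i s else 0) \<longlonglongrightarrow> (if s \<in> E then f s else 0)"
    if "s \<in> space M" for s
    using h(2)[OF that] by simp
  ultimately show ?thesis
    unfolding strongly_measurable_def
    by (intro exI[of _ "\<lambda>i s. if s \<in> E then h i s else 0"]) simp
qed

lemma Lp_fun_add:
  assumes "f \<in> Lp_fun p M" "g \<in> Lp_fun p M" "p > 0"
  shows "(\<lambda>s. f s + g s) \<in> Lp_fun p M"
proof -
  have meas: "strongly_measurable M (\<lambda>s. f s + g s)"
    using assms strongly_measurable_add by (auto simp: Lp_fun_def)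
  have bound: "norm (x + y) powr p \<le> 2 powr p * (norm x powr p + norm y powr p)" for x y :: 'b
  proof -
    have "norm (x + y) \<le> 2 * max (norm x) (norm y)"
      using norm_triangle_ineq[of x y] by linarith
    then have "norm (x + y) powr p \<le> (2 * max (norm x) (norm y)) powr p"
      using assms(3) by (intro powr_mono2) auto
    also have "\<dots> = 2 powr p * max (norm x) (norm y) powr p"
      by (subst powr_mult) (auto simp: max_def)
    also have "\<dots> \<le> 2 powr p * (norm x powr p + norm y powr p)"
      by (intro mult_left_mono) (auto simp: max_def)
    finally show ?thesis .
  qed
  have "integrable M (\<lambda>s. 2 powr p * (norm (f s) powr p + norm (g s) powr p))"
    using assms by (auto simp: Lp_fun_def)
  moreover have "(\<lambda>s. norm (f s + g s) powr p) \<in> borel_measurable M"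
    using strongly_measurable_norm[OF meas] by simp
  ultimately have "integrable M (\<lambda>s. norm (f s + g s) powr p)"
    by (rule Bochner_Integration.integrable_bound) (simp add: bound)
  with meas show ?thesis by (simp add: Lp_fun_def)
qed

lemma Lp_fun_scale:
  assumes "f \<in> Lp_fun p M"
  shows "(\<lambda>s. c *\<^sub>R f s) \<in> Lp_fun p M"
  using assms by (auto simp: Lp_fun_def strongly_measurable_scale powr_mult)

lemma Lp_fun_restrict:
  assumes "f \<in> Lp_fun p M" "E \<in> sets M"
  shows "(\<lambda>s. if s \<in> E then f s else 0) \<in> Lp_fun p M"
proof -
  have "integrable M (\<lambda>s. indicator E s *\<^sub>R norm (f s) powr p)"
    using assms by (intro integrable_mult_indicator) (auto simp: Lp_fun_def)
  also have "(\<lambda>s. indicator E s *\<^sub>R norm (f s) powr p) = (\<lambda>s. norm (if s \<in> E then f s else 0) powr p)"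
    by (auto simp: indicator_def)
  finally show ?thesis
    using assms by (auto simp: Lp_fun_def strongly_measurable_restrict)
qed

lemma equiv_Lp_rel: "equiv (Lp_fun p M) (Lp_rel p M)"
  by (intro equivI refl_onI symI transI) (auto simp: Lp_rel_def)

lemma Lp_class_cong:
  assumes "(f, g) \<in> Lp_rel p M"
  shows "Lp_rel p M `` {f} = Lp_rel p M `` {g}"
  using equiv_class_eq[OF equiv_Lp_rel assms] .

lemma Lp_norm_class:
  assumes "f \<in> Lp_fun p M"
  shows "Lp_norm p M (Lp_rel p M `` {f}) = (\<integral>s. norm (f s) powr p \<partial>M) powr (1 / p)"
proof -
  have *: "(\<integral>s. norm (g s) powr p \<partial>M) = (\<integral>s. norm (f s) powr p \<partial>M)" if "(f, g) \<in> Lp_rel p M" for g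
  proof (rule integral_cong_AE)
    show "AE s in M. norm (g s) powr p = norm (f s) powr p"
      using that by (auto simp: Lp_rel_def)
  qed (use that in \<open>auto simp: Lp_rel_def Lp_fun_def\<close>)
  have "f \<in> Lp_rel p M `` {f}"
    using assms by (simp add: Lp_rel_def)
  then show ?thesis
    unfolding Lp_norm_def by (intro the_elem_image_unique) (blast, subst *, auto)
qed

lemma Lp_scale_class:
  assumes "f \<in> Lp_fun p M"
  shows "Lp_scale p M c (Lp_rel p M `` {f}) = Lp_rel p M `` {\<lambda>s. c *\<^sub>R f s}"
proof -
  have "((\<lambda>s. c *\<^sub>R f1 s), (\<lambda>s. c *\<^sub>R f2 s)) \<in> Lp_rel p M"
    if "(f1, f2) \<in> Lp_rel p M" for f1 f2 :: "'a \<Rightarrow> 'b"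
    using that by (auto simp: Lp_rel_def Lp_fun_scale)
  then have "congruent (Lp_rel p M) (\<lambda>f. Lp_rel p M `` {\<lambda>s. c *\<^sub>R f s :: 'b})"
    by (intro congruentI Lp_class_cong)
  from UN_equiv_class[OF equiv_Lp_rel this assms] show ?thesis
    unfolding Lp_scale_def .
qed

lemma Lp_restrict_class:
  assumes "f \<in> Lp_fun p M" "E \<in> sets M"
  shows "Lp_restrict p M E (Lp_rel p M `` {f}) = Lp_rel p M `` {\<lambda>s. if s \<in> E then f s else 0}"
proof -
  have "((\<lambda>s. if s \<in> E then f1 s else 0), (\<lambda>s. if s \<in> E then f2 s else 0)) \<in> Lp_rel p M"
    if "(f1, f2) \<in> Lp_rel p M" for f1 f2 :: "'a \<Rightarrow> 'b"
    using that assms(2) by (auto simp: Lp_rel_def Lp_fun_restrict elim!: eventually_mono)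
  then have "congruent (Lp_rel p M) (\<lambda>f. Lp_rel p M `` {\<lambda>s. if s \<in> E then f s else 0 :: 'b})"
    by (intro congruentI Lp_class_cong)
  from UN_equiv_class[OF equiv_Lp_rel this assms(1)] show ?thesis
    unfolding Lp_restrict_def .
qed

lemma Lp_add_class:
  assumes "f \<in> Lp_fun p M" "g \<in> Lp_fun p M" "p > 0"
  shows "Lp_add p M (Lp_rel p M `` {f}) (Lp_rel p M `` {g}) = Lp_rel p M `` {\<lambda>s. f s + g s}"
proof -
  have "((\<lambda>s. f1 s + g1 s), (\<lambda>s. f2 s + g2 s)) \<in> Lp_rel p M"
    if "(f1, f2) \<in> Lp_rel p M" "(g1, g2) \<in> Lp_rel p M" for f1 f2 g1 g2 :: "'a \<Rightarrow> 'b"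
    using that assms(3) by (auto simp: Lp_rel_def Lp_fun_add elim!: eventually_elim2)
  then have "congruent2 (Lp_rel p M) (Lp_rel p M) (\<lambda>f g. Lp_rel p M `` {\<lambda>s. f s + g s :: 'b})"
    by (auto simp: congruent2_def intro!: Lp_class_cong)
  from UN_equiv_class2[OF equiv_Lp_rel equiv_Lp_rel this assms(1,2)] show ?thesis
    unfolding Lp_add_def .
qed

lemma Lp_restrict_in_Lp_on:
  assumes "u \<in> Lp p M" "E \<in> sets M"
  shows "Lp_restrict p M E u \<in> Lp_on p M E"
proof -
  obtain f where f: "f \<in> Lp_fun p M" "u = Lp_rel p M `` {f}"
    using assms(1) by (auto simp: Lp_def elim: quotientE)
  have "Lp_restrict p M E u \<in> Lp p M"
    using f assms(2) by (simp add: Lp_restrict_class Lp_def quotientI Lp_fun_restrict)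
  moreover have "Lp_restrict p M E u = Lp_rel p M `` {\<lambda>s. if s \<in> E then f s else 0}"
    using f assms(2) by (simp add: Lp_restrict_class)
  ultimately show ?thesis
    by (auto simp: Lp_on_def Lp_rel_def elim!: eventually_mono split: if_splits)
qed

end

theory Submission
  imports Defs
begin

text \<open>
  Write \<open>R\<close> for the norm of \<open>g\<^sub>A\<close> and suppose that \<open>R > r\<close>; put \<open>t = r / R\<close>. If \<open>z\<close> lies in the
  cylinder at distance at most \<open>R - r\<close> from \<open>g\<close>, then \<open>g\<^sub>A = t a + (1 - t) b\<close> with
  \<open>a = z\<^sub>A / t\<close> and \<open>b = (g\<^sub>A - z\<^sub>A) / (1 - t)\<close>, both of norm at most \<open>R\<close>. As \<open>g\<^sub>A\<close> itself has
  norm \<open>R\<close>, integrating the pointwise convexity inequality of \<open>\<parallel>\<cdot>\<parallel>\<^sup>p\<close> forces equality almost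
  everywhere, and strict convexity gives \<open>a = b\<close>, i.e. \<open>z\<^sub>A = t g\<^sub>A\<close>. The part on \<open>A\<close> then already uses up
  the whole distance, so \<open>z = g\<close> off \<open>A\<close>. Existence and uniqueness of the
  nearest point come out together, without Minkowski's inequality.
\<close>

section \<open>Strict convexity of the norm and of its \<open>p\<close>-th power\<close>

lemma uniformly_convex_strict:
  fixes x y :: "'x::real_normed_vector"
  assumes "uniformly_convex TYPE('x)" "norm x = c" "norm y = c" "x \<noteq> y"
  shows "norm (x + y) < 2 * c"
proof -
  have "c > 0"
    using assms(2-4) norm_ge_zero[of x] by (cases "c = 0") auto
  \<comment> \<open>Dividing by \<open>c\<close> moves both points to the unit sphere; their
    distance there serves as the \<epsilon> of \<open>uniformly_convex\<close>.\<close>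
  have "norm ((1 / c) *\<^sub>R x - (1 / c) *\<^sub>R y) > 0"
    using \<open>c > 0\<close> assms(4) by simp
  then obtain \<delta> where "\<delta> > 0"
    "norm ((1 / 2) *\<^sub>R ((1 / c) *\<^sub>R x + (1 / c) *\<^sub>R y)) \<le> 1 - \<delta>"
    using assms(1-3) \<open>c > 0\<close> unfolding uniformly_convex_def
    by (metis (no_types, lifting) abs_of_pos divide_pos_pos less_numeral_extra(1) nonzero_eq_divide_eq
        norm_scaleR order_less_irrefl order_refl)
  moreover have "norm ((1 / 2) *\<^sub>R ((1 / c) *\<^sub>R x + (1 / c) *\<^sub>R y)) = norm (x + y) / (2 * c)"
    using \<open>c > 0\<close> by (simp flip: scaleR_add_right)
  ultimately have "norm (x + y) / (2 * c) < 1"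
    by linarith
  then show ?thesis
    using \<open>c > 0\<close> by simp
qed

text \<open>Every proper convex combination reduces to the midpoint case: it lies between the
  midpoint and one of the endpoints. The auxiliary fact \<open>half\<close> treats \<open>t\<close>
  up to \<open>1 / 2\<close>; exchanging \<open>x\<close> and \<open>y\<close> gives the
  rest.\<close>

lemma uniformly_convex_strict_combination:
  fixes x y :: "'x::real_normed_vector"
  assumes "uniformly_convex TYPE('x)" "norm x = c" "norm y = c" "x \<noteq> y" "0 < t" "t < 1"
  shows "norm (t *\<^sub>R x + (1 - t) *\<^sub>R y) < c"
proof -
  have half: "norm (t *\<^sub>R x + (1 - t) *\<^sub>R y) < c"
    if "norm x = c" "norm y = c" "x \<noteq> y" "0 < t" "t \<le> 1 / 2" for x y :: 'x and t
  proof -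
    \<comment> \<open>The midpoint carries weight \<open>2 * t\<close> and \<open>y\<close> carries
      \<open>1 - 2 * t\<close>, which is nonnegative because \<open>t\<close> is at most
      \<open>1 / 2\<close>.\<close>
    have "t *\<^sub>R x + (1 - t) *\<^sub>R y = t *\<^sub>R (x + y) + (1 - 2 * t) *\<^sub>R y"
      by (simp add: algebra_simps scaleR_2 flip: scaleR_scaleR)
    also have "norm \<dots> \<le> t * norm (x + y) + (1 - 2 * t) * c"
      using that norm_triangle_ineq[of "t *\<^sub>R (x + y)" "(1 - 2 * t) *\<^sub>R y"] by simp
    also have "\<dots> < t * (2 * c) + (1 - 2 * t) * c"
      using uniformly_convex_strict[OF assms(1) that(1-3)] that(4) by simp
    finally show ?thesis
      by (simp add: algebra_simps)
  qed
  show ?thesis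
    using half[of x y t] half[of y x "1 - t"] assms by (cases "t \<le> 1 / 2") (auto simp: add.commute)
qed

text \<open>The right-hand graph lies strictly above its tangent at \<open>1\<close>. On either side
  of \<open>1\<close> the mean value theorem compares the slope \<open>p * z powr (p - 1)\<close>
  with the slope \<open>p\<close> at \<open>1\<close>; the point \<open>0\<close>, where
  \<open>powr\<close> is not differentiated, is checked directly.\<close>

lemma powr_Bernoulli_strict:
  fixes x p :: real
  assumes "0 \<le> x" "x \<noteq> 1" "1 < p"
  shows "1 + p * (x - 1) < x powr p"
proof -
  have deriv: "((\<lambda>u. u powr p) has_real_derivative p * u powr (p - 1)) (at u)" if "0 < u" for u
    using that by (rule has_real_derivative_powr)
  consider "x = 0" | "0 < x" "x < 1" | "1 < x"
    using assms by linarith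
  then show ?thesis
  proof cases
    case 1
    then show ?thesis using assms by simp
  next
    case 2
    then obtain z where z: "x < z" "z < 1" "1 powr p - x powr p = (1 - x) * (p * z powr (p - 1))"
      using MVT2[of x 1 "\<lambda>u. u powr p" "\<lambda>u. p * u powr (p - 1)"] deriv by force
    have "z powr (p - 1) < 1"
      using z 2 assms powr_less_mono2[of "p - 1" z 1] by simp
    then have "(1 - x) * (p * z powr (p - 1)) < (1 - x) * (p * 1)"
      using 2 assms by (intro mult_strict_left_mono) auto
    with z(3) show ?thesis by (simp add: algebra_simps)
  next
    case 3
    then obtain z where z: "1 < z" "x powr p - 1 powr p = (x - 1) * (p * z powr (p - 1))"
      using MVT2[of 1 x "\<lambda>u. u powr p" "\<lambda>u. p * u powr (p - 1)"] deriv by force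
    have "1 < z powr (p - 1)"
      using z 3 assms powr_less_mono2[of "p - 1" 1 z] by simp
    then have "(x - 1) * (p * 1) < (x - 1) * (p * z powr (p - 1))"
      using 3 assms by (intro mult_strict_left_mono) auto
    with z(2) show ?thesis by (simp add: algebra_simps)
  qed
qed

text \<open>Both \<open>u\<close> and \<open>v\<close> lie strictly above the tangent at their
  weighted mean \<open>w\<close>. Averaging the two tangent inequalities cancels the linear
  terms.\<close>

lemma powr_strict_convex:
  fixes u v p t :: real
  assumes "0 \<le> u" "0 \<le> v" "u \<noteq> v" "1 < p" "0 < t" "t < 1"
  shows "(t * u + (1 - t) * v) powr p < t * u powr p + (1 - t) * v powr p"
proof -
  define w where "w = t * u + (1 - t) * v"
  have uw: "u - w = (1 - t) * (u - v)" and vw: "v - w = t * (v - u)"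
    by (simp_all add: w_def algebra_simps)
  then have neq: "u \<noteq> w" "v \<noteq> w"
    using assms by auto
  \<comment> \<open>Distinct nonnegative numbers are not both zero, so \<open>w\<close> is positive
    and may be divided by.\<close>
  have "0 < t * u \<or> 0 < (1 - t) * v"
    using assms by (cases "u = 0") auto
  then have "w > 0"
    unfolding w_def using assms by (auto intro: add_pos_nonneg add_nonneg_pos)
  \<comment> \<open>The tangent inequality at \<open>w\<close> is Bernoulli's inequality at
    \<open>x / w\<close>, multiplied by \<open>w powr p\<close>.\<close>
  have tangent: "w powr p + w powr p * (p * (x / w - 1)) < x powr p" if "0 \<le> x" "x \<noteq> w" for x
  proof -
    have "w powr p * (1 + p * (x / w - 1)) < w powr p * (x / w) powr p"
      using powr_Bernoulli_strict[of "x / w" p] that \<open>w > 0\<close> assms by simp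
    also have "\<dots> = x powr p"
      using that \<open>w > 0\<close> by (simp flip: powr_mult)
    finally show ?thesis
      by (simp add: algebra_simps)
  qed
  have "t * (w powr p + w powr p * (p * (u / w - 1))) +
      (1 - t) * (w powr p + w powr p * (p * (v / w - 1))) < t * u powr p + (1 - t) * v powr p"
    using tangent[of u] tangent[of v] neq assms by (intro add_strict_mono mult_strict_left_mono) auto
  moreover have "t * (w powr p + w powr p * (p * (u / w - 1))) +
      (1 - t) * (w powr p + w powr p * (p * (v / w - 1)))
      = w powr p + w powr p * p * ((t * u + (1 - t) * v) / w - 1)"
    using \<open>w > 0\<close> by (simp add: field_simps)
  moreover have "(t * u + (1 - t) * v) / w = 1"
    using \<open>w > 0\<close> by (simp add: w_def)
  ultimately show ?thesis
    by (simp add: w_def)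
qed

text \<open>Strictness has two sources: for equal norms it comes from the geometry of the space, for
  different norms from the strict convexity of the real power.\<close>

lemma norm_powr_strict_convex:
  fixes x y :: "'x::real_normed_vector"
  assumes "uniformly_convex TYPE('x)" "x \<noteq> y" "1 < p" "0 < t" "t < 1"
  shows "norm (t *\<^sub>R x + (1 - t) *\<^sub>R y) powr p < t * norm x powr p + (1 - t) * norm y powr p"
proof (cases "norm x = norm y")
  case True
  then have "norm (t *\<^sub>R x + (1 - t) *\<^sub>R y) < norm x"
    using uniformly_convex_strict_combination[OF assms(1) _ _ assms(2,4,5)] by simp
  then have "norm (t *\<^sub>R x + (1 - t) *\<^sub>R y) powr p < norm x powr p"
    using assms(3) by (intro powr_less_mono2) auto
  with True show ?thesis
    by (simp add: algebra_simps)
next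
  case False
  have "norm (t *\<^sub>R x + (1 - t) *\<^sub>R y) \<le> t * norm x + (1 - t) * norm y"
    using assms norm_triangle_ineq[of "t *\<^sub>R x" "(1 - t) *\<^sub>R y"] by simp
  then have "norm (t *\<^sub>R x + (1 - t) *\<^sub>R y) powr p \<le> (t * norm x + (1 - t) * norm y) powr p"
    using assms by (intro powr_mono2) auto
  also have "\<dots> < t * norm x powr p + (1 - t) * norm y powr p"
    using False assms by (intro powr_strict_convex) auto
  finally show ?thesis .
qed

section \<open>Integrals of \<open>p\<close>-th powers of norms\<close>

text \<open>The pointwise convexity defect \<open>D\<close> is nonnegative and positive wherever
  \<open>a\<close> and \<open>b\<close> differ, while the three integral bounds make its integral at
  most \<open>0\<close>. Hence \<open>D\<close> vanishes almost everywhere.\<close>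

lemma Lp_fun_integral_strict_convex:
  fixes a b :: "'s \<Rightarrow> 'x::real_normed_vector"
  assumes uc: "uniformly_convex TYPE('x)" and p: "1 < p" and t: "0 < t" "t < 1"
    and Lp: "a \<in> Lp_fun p M" "b \<in> Lp_fun p M"
    and le: "(\<integral>s. norm (a s) powr p \<partial>M) \<le> c" "(\<integral>s. norm (b s) powr p \<partial>M) \<le> c"
    and ge: "c \<le> (\<integral>s. norm (t *\<^sub>R a s + (1 - t) *\<^sub>R b s) powr p \<partial>M)"
  shows "AE s in M. a s = b s"
proof -
  define D where "D s = t * norm (a s) powr p + (1 - t) * norm (b s) powr p
    - norm (t *\<^sub>R a s + (1 - t) *\<^sub>R b s) powr p" for s
  have D_pos: "a s \<noteq> b s \<Longrightarrow> D s > 0" for s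
    unfolding D_def using norm_powr_strict_convex[OF uc _ p t] by fastforce
  have D_zero: "a s = b s \<Longrightarrow> D s = 0" for s
    unfolding D_def by (simp add: algebra_simps)
  have D_nonneg: "0 \<le> D s" for s
    using D_pos[of s] D_zero[of s] by fastforce
  have "(\<lambda>s. t *\<^sub>R a s + (1 - t) *\<^sub>R b s) \<in> Lp_fun p M"
    using Lp p by (intro Lp_fun_add Lp_fun_scale) auto
  then have int: "integrable M (\<lambda>s. norm (a s) powr p)" "integrable M (\<lambda>s. norm (b s) powr p)"
    "integrable M (\<lambda>s. norm (t *\<^sub>R a s + (1 - t) *\<^sub>R b s) powr p)"
    using Lp by (simp_all add: Lp_fun_def)
  then have D_int: "integrable M D"
    unfolding D_def by simp
  have "integral\<^sup>L M D = t * (\<integral>s. norm (a s) powr p \<partial>M) + (1 - t) * (\<integral>s. norm (b s) powr p \<partial>M)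
      - (\<integral>s. norm (t *\<^sub>R a s + (1 - t) *\<^sub>R b s) powr p \<partial>M)"
    unfolding D_def using int by simp
  also have "\<dots> \<le> t * c + (1 - t) * c - c"
    using le ge t by (intro diff_mono add_mono mult_left_mono) auto
  finally have "integral\<^sup>L M D \<le> 0"
    by (simp add: algebra_simps)
  moreover have "0 \<le> integral\<^sup>L M D"
    using D_nonneg by (simp add: Bochner_Integration.integral_nonneg)
  ultimately have "AE s in M. D s = 0"
    using integral_nonneg_eq_0_iff_AE[OF D_int] D_nonneg by simp
  then show ?thesis
  proof (rule eventually_mono)
    show "a s = b s" if "D s = 0" for s
      using D_pos[of s] that by fastforce
  qed
qed

text \<open>At each point of the space one of the two summands is \<open>0\<close>. Applied to a
  difference, this separates the contributions of \<open>A\<close> and of its complement to a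
  distance.\<close>

lemma Lp_fun_integral_split:
  fixes f :: "'s \<Rightarrow> 'x::real_normed_vector"
  assumes "f \<in> Lp_fun p M" "A \<in> sets M"
  shows "(\<integral>s. norm (f s) powr p \<partial>M) = (\<integral>s. norm (if s \<in> A then f s else 0) powr p \<partial>M)
    + (\<integral>s. norm (if s \<in> space M - A then f s else 0) powr p \<partial>M)"
proof -
  have "(\<lambda>s. if s \<in> A then f s else 0) \<in> Lp_fun p M"
    "(\<lambda>s. if s \<in> space M - A then f s else 0) \<in> Lp_fun p M"
    using assms by (intro Lp_fun_restrict; auto)+
  then have "(\<integral>s. norm (if s \<in> A then f s else 0) powr p \<partial>M)
      + (\<integral>s. norm (if s \<in> space M - A then f s else 0) powr p \<partial>M)
      = (\<integral>s. norm (if s \<in> A then f s else 0) powr p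
        + norm (if s \<in> space M - A then f s else 0) powr p \<partial>M)"
    by (subst Bochner_Integration.integral_add) (simp_all only: Lp_fun_def mem_Collect_eq)
  also have "\<dots> = (\<integral>s. norm (f s) powr p \<partial>M)"
    by (rule Bochner_Integration.integral_cong) auto
  finally show ?thesis by simp
qed

lemma Lp_fun_integral_scale:
  assumes "0 \<le> c"
  shows "(\<integral>s. norm (c *\<^sub>R f s) powr p \<partial>M) = c powr p * (\<integral>s. norm (f s) powr p \<partial>M)"
  using assms by (simp add: powr_mult)

lemma Lp_fun_integral_eq_0:
  assumes "f \<in> Lp_fun p M" "(\<integral>s. norm (f s) powr p \<partial>M) \<le> 0"
  shows "AE s in M. f s = 0"
proof -
  have "(\<integral>s. norm (f s) powr p \<partial>M) = 0"
    using assms(2) by (intro antisym Bochner_Integration.integral_nonneg) auto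
  then have "AE s in M. norm (f s) powr p = 0"
    using assms(1) by (subst (asm) integral_nonneg_eq_0_iff_AE) (auto simp: Lp_fun_def)
  then show ?thesis
    by (auto elim!: eventually_mono)
qed

lemma Lp_fun_diff:
  assumes "f \<in> Lp_fun p M" "h \<in> Lp_fun p M" "p > 0"
  shows "(\<lambda>s. f s - h s) \<in> Lp_fun p M"
  using Lp_fun_add[OF assms(1) Lp_fun_scale[OF assms(2), of "- 1"] assms(3)] by simp

section \<open>Nearest points of the cylinder, for representatives\<close>

lemma nearest_in_cylinder_AE:
  fixes f h :: "'s \<Rightarrow> 'x::real_normed_vector"
  assumes uc: "uniformly_convex TYPE('x)" and p: "1 < p" and A: "A \<in> sets M"
    and Lp: "f \<in> Lp_fun p M" "h \<in> Lp_fun p M"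
    and r: "0 < r" "r < R"
    and f: "(\<integral>s. norm (if s \<in> A then f s else 0) powr p \<partial>M) = R powr p"
    and h: "(\<integral>s. norm (if s \<in> A then h s else 0) powr p \<partial>M) \<le> r powr p"
    and dist: "(\<integral>s. norm (f s - h s) powr p \<partial>M) \<le> (R - r) powr p"
  shows "AE s in M. h s =
    (r / R) *\<^sub>R (if s \<in> A then f s else 0) + (if s \<in> space M - A then f s else 0)"
proof -
  define fA where "fA s = (if s \<in> A then f s else 0)" for s
  define hA where "hA s = (if s \<in> A then h s else 0)" for s
  define t where "t = r / R"
  have t: "0 < t" "t < 1"
    using r by (auto simp: t_def)
  \<comment> \<open>These identities rescale the bounds \<open>r\<close> and \<open>R - r\<close> to
    the common bound \<open>R\<close>, and turn \<open>R\<close> back into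
    \<open>R - r\<close>.\<close>
  have tR: "(1 / t) powr p * r powr p = R powr p" "(1 / (1 - t)) powr p * (R - r) powr p = R powr p"
    "(1 - t) powr p * R powr p = (R - r) powr p"
  proof -
    have eq: "1 / t * r = R" "(1 - t) * R = R - r"
      using r by (auto simp: t_def field_simps)
    have eq': "1 / (1 - t) * (R - r) = R"
      using t by (simp flip: eq(2))
    show "(1 / t) powr p * r powr p = R powr p"
      "(1 / (1 - t)) powr p * (R - r) powr p = R powr p" "(1 - t) powr p * R powr p = (R - r) powr p"
      by (simp_all only: powr_mult[symmetric] eq eq')
  qed
  have LpA: "fA \<in> Lp_fun p M" "hA \<in> Lp_fun p M"
    unfolding fA_def hA_def using Lp A by (auto intro!: Lp_fun_restrict)
  have d_split: "(\<integral>s. norm (f s - h s) powr p \<partial>M) = (\<integral>s. norm (fA s - hA s) powr p \<partial>M)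
      + (\<integral>s. norm (if s \<in> space M - A then f s - h s else 0) powr p \<partial>M)"
  proof -
    have "(if s \<in> A then f s - h s else 0) = fA s - hA s" for s
      by (simp add: fA_def hA_def)
    with Lp_fun_integral_split[OF Lp_fun_diff[OF Lp] A] p show ?thesis
      by simp
  qed
  have "0 \<le> (\<integral>s. norm (if s \<in> space M - A then f s - h s else 0) powr p \<partial>M)"
    by (intro Bochner_Integration.integral_nonneg) simp
  then have dA: "(\<integral>s. norm (fA s - hA s) powr p \<partial>M) \<le> (R - r) powr p"
    using d_split dist by linarith
  have "AE s in M. (1 / t) *\<^sub>R hA s = (1 / (1 - t)) *\<^sub>R (fA s - hA s)"
  proof (rule Lp_fun_integral_strict_convex[OF uc p t])
    show "(\<lambda>s. (1 / t) *\<^sub>R hA s) \<in> Lp_fun p M" "(\<lambda>s. (1 / (1 - t)) *\<^sub>R (fA s - hA s)) \<in> Lp_fun p M"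
      using LpA p by (intro Lp_fun_scale Lp_fun_diff; simp)+
    show "(\<integral>s. norm ((1 / t) *\<^sub>R hA s) powr p \<partial>M) \<le> R powr p"
      using h t by (subst Lp_fun_integral_scale) (auto simp: hA_def simp flip: tR(1) intro!: mult_left_mono)
    show "(\<integral>s. norm ((1 / (1 - t)) *\<^sub>R (fA s - hA s)) powr p \<partial>M) \<le> R powr p"
      using dA t by (subst Lp_fun_integral_scale) (auto simp flip: tR(2) intro!: mult_left_mono)
    \<comment> \<open>The factors cancel, so the convex combination is \<open>fA\<close>, whose
      integral equals \<open>R powr p\<close>.\<close>
    show "R powr p \<le> (\<integral>s. norm (t *\<^sub>R ((1 / t) *\<^sub>R hA s)
        + (1 - t) *\<^sub>R ((1 / (1 - t)) *\<^sub>R (fA s - hA s))) powr p \<partial>M)"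
      using f t by (simp add: fA_def)
  qed
  then have hA: "AE s in M. hA s = t *\<^sub>R fA s"
  proof (rule eventually_mono)
    fix s assume "(1 / t) *\<^sub>R hA s = (1 / (1 - t)) *\<^sub>R (fA s - hA s)"
    \<comment> \<open>Multiplication by \<open>t * (1 - t)\<close> clears both denominators.\<close>
    then have "(t * (1 - t)) *\<^sub>R ((1 / t) *\<^sub>R hA s) = (t * (1 - t)) *\<^sub>R ((1 / (1 - t)) *\<^sub>R (fA s - hA s))"
      by simp
    then have "(1 - t) *\<^sub>R hA s = t *\<^sub>R (fA s - hA s)"
      using t by simp
    then show "hA s = t *\<^sub>R fA s"
      by (simp add: algebra_simps)
  qed
  \<comment> \<open>The contribution of \<open>A\<close> is now exactly
    \<open>(R - r) powr p\<close>, which leaves nothing for the complement.\<close>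
  have "(\<integral>s. norm (fA s - hA s) powr p \<partial>M) = (\<integral>s. norm ((1 - t) *\<^sub>R fA s) powr p \<partial>M)"
  proof (rule integral_cong_AE)
    show "AE s in M. norm (fA s - hA s) powr p = norm ((1 - t) *\<^sub>R fA s) powr p"
      using hA by eventually_elim (simp add: algebra_simps)
    show "(\<lambda>s. norm (fA s - hA s) powr p) \<in> borel_measurable M"
      using Lp_fun_diff[OF LpA] p by (simp add: Lp_fun_def borel_measurable_integrable)
    show "(\<lambda>s. norm ((1 - t) *\<^sub>R fA s) powr p) \<in> borel_measurable M"
      using Lp_fun_scale[OF LpA(1)] by (simp only: Lp_fun_def mem_Collect_eq borel_measurable_integrable)
  qed
  also have "\<dots> = (R - r) powr p"
    using t f by (subst Lp_fun_integral_scale) (auto simp: fA_def tR(3))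
  finally have off: "(\<integral>s. norm (if s \<in> space M - A then f s - h s else 0) powr p \<partial>M) \<le> 0"
    using d_split dist by linarith
  have "AE s in M. (if s \<in> space M - A then f s - h s else 0) = 0"
    using Lp p A off by (intro Lp_fun_integral_eq_0 Lp_fun_restrict Lp_fun_diff) auto
  \<comment> \<open>\<open>AE_space\<close> enters because the complement is
    \<open>space M - A\<close>: nothing is known about \<open>h\<close> at points outside the
    space.\<close>
  with hA AE_space show ?thesis
    by eventually_elim (auto simp: fA_def hA_def t_def split: if_splits)
qed

section \<open>Passage to equivalence classes\<close>

lemma Lp_dist_class:
  assumes "f \<in> Lp_fun p M" "h \<in> Lp_fun p M" "p > 0"
  shows "Lp_dist p M (Lp_rel p M `` {f}) (Lp_rel p M `` {h})
    = (\<integral>s. norm (f s - h s) powr p \<partial>M) powr (1 / p)"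
proof -
  have "Lp_add p M (Lp_rel p M `` {f}) (Lp_scale p M (- 1) (Lp_rel p M `` {h}))
      = Lp_rel p M `` {\<lambda>s. f s + (- 1) *\<^sub>R h s}"
    by (simp only: Lp_scale_class[OF assms(2)] Lp_add_class[OF assms(1) Lp_fun_scale[OF assms(2)] assms(3)])
  then show ?thesis
    using Lp_norm_class[OF Lp_fun_diff[OF assms]] by (simp add: Lp_dist_def)
qed

lemma Lp_class_eq_iff:
  assumes "f \<in> Lp_fun p M" "h \<in> Lp_fun p M"
  shows "Lp_rel p M `` {f} = Lp_rel p M `` {h} \<longleftrightarrow> (AE s in M. f s = h s)"
  using eq_equiv_class_iff[OF equiv_Lp_rel assms] assms by (simp add: Lp_rel_def)

lemma Lp_class_in_cylinder_iff:
  assumes "f \<in> Lp_fun p M" "A \<in> sets M"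
  shows "Lp_rel p M `` {f} \<in> cylinder p M A r \<longleftrightarrow>
    (\<integral>s. norm (if s \<in> A then f s else 0) powr p \<partial>M) powr (1 / p) \<le> r"
  using assms
  by (simp add: cylinder_def Lp_def quotientI Lp_restrict_class Lp_norm_class Lp_fun_restrict)

lemma powr_inverse_le_iff:
  fixes x y p :: real
  assumes "0 \<le> x" "0 \<le> y" "0 < p"
  shows "x powr (1 / p) \<le> y \<longleftrightarrow> x \<le> y powr p"
proof -
  have "x powr (1 / p) \<le> y \<longleftrightarrow> (x powr (1 / p)) powr p \<le> y powr p"
    using assms by (metis powr_ge_zero powr_mono2 powr_less_mono2 not_le less_imp_le)
  then show ?thesis
    using assms by (simp add: powr_powr)
qed

text \<open>A competitor strictly closer than \<open>y\<close> would have to equal \<open>y\<close>,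
  so \<open>y\<close> is nearest; any other nearest point is at least as close as \<open>y\<close>
  and hence coincides with it.\<close>

lemma nearest_point_strict:
  assumes "y \<in> C" "\<And>z. z \<in> C \<Longrightarrow> d x z \<le> d x y \<Longrightarrow> z = y"
  shows "nearest_point d C x z \<longleftrightarrow> z = y"
  using assms unfolding nearest_point_def by (metis linear)

theorem theorem4p7:
  fixes M :: "'s measure" and A :: "'s set" and p r :: real
    and g :: "('s \<Rightarrow> 'x::banach) set"
  assumes "uniformly_convex TYPE('x)" and "uniformly_smooth TYPE('x)"
    and "1 < p"
    and "A \<in> sets M" and "emeasure M A > 0"
    and "r > 0"
    and "g \<in> Lp p M"
  shows "(\<exists>!y. nearest_point (Lp_dist p M) (cylinder p M A r) g y) \<and>
    (g \<in> cylinder p M A r \<longrightarrow>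
       metric_projection (Lp_dist p M) (cylinder p M A r) g = g) \<and>
    (g \<notin> cylinder p M A r \<longrightarrow>
       metric_projection (Lp_dist p M) (cylinder p M A r) g =
         Lp_add p M
           (Lp_scale p M (r / Lp_norm p M (Lp_restrict p M A g)) (Lp_restrict p M A g))
           (Lp_restrict p M (space M - A) g))"
proof -
  let ?C = "cylinder p M A r" and ?d = "Lp_dist p M"
  let ?cl = "\<lambda>f. Lp_rel p M `` {f :: 's \<Rightarrow> 'x}"
  obtain f where f: "f \<in> Lp_fun p M" and g: "g = ?cl f"
    using assms(7) by (auto simp: Lp_def elim: quotientE)
  have p: "p > 0"
    using assms(3) by simp
  have in_C: "\<exists>h \<in> Lp_fun p M. z = ?cl h" if "z \<in> ?C" for z
    using that by (auto simp: cylinder_def Lp_def elim: quotientE)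
  define R where "R = Lp_norm p M (Lp_restrict p M A g)"
  \<comment> \<open>The claimed value in both cases at once, so that one equivalence yields
    existence, uniqueness and the formula.\<close>
  define y where "y = (if g \<in> ?C then g else
    Lp_add p M (Lp_scale p M (r / R) (Lp_restrict p M A g)) (Lp_restrict p M (space M - A) g))"
  have "nearest_point ?d ?C g z \<longleftrightarrow> z = y" for z
  proof (cases "g \<in> ?C")
    case True
    then have y: "y = g" by (simp add: y_def)
    show ?thesis
    proof (rule nearest_point_strict)
      show "y \<in> ?C" using True y by simp
      fix z assume z: "z \<in> ?C" "?d g z \<le> ?d g y"
      then obtain h where h: "h \<in> Lp_fun p M" "z = ?cl h"
        using in_C by blast
      have "?d g y = 0"
        using f p by (simp add: y g Lp_dist_class)
      then have "(\<integral>s. norm (f s - h s) powr p \<partial>M) powr (1 / p) \<le> 0"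
        using z(2) f h p by (simp add: g Lp_dist_class)
      then have "(\<integral>s. norm (f s - h s) powr p \<partial>M) \<le> 0"
        by simp
      then have "AE s in M. f s - h s = 0"
        using f h p by (intro Lp_fun_integral_eq_0 Lp_fun_diff)
      then show "z = y"
        using f h by (auto simp: y g Lp_class_eq_iff)
    qed
  next
    case False
    let ?fA = "\<lambda>s. if s \<in> A then f s else 0" and ?fB = "\<lambda>s. if s \<in> space M - A then f s else 0"
    have fA: "?fA \<in> Lp_fun p M" and fB: "?fB \<in> Lp_fun p M"
      using f assms(4) by (intro Lp_fun_restrict; auto)+
    have R: "R = (\<integral>s. norm (?fA s) powr p \<partial>M) powr (1 / p)"
      unfolding R_def g using f fA assms(4) by (simp add: Lp_restrict_class Lp_norm_class)
    then have "r < R"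
      using False f assms(4) by (simp add: g Lp_class_in_cylinder_iff)
    have Rp: "(\<integral>s. norm (?fA s) powr p \<partial>M) = R powr p"
      unfolding R using p by (simp add: powr_powr Bochner_Integration.integral_nonneg)
    \<comment> \<open>A representative of the claimed projection.\<close>
    define k where "k s = (r / R) *\<^sub>R ?fA s + ?fB s" for s
    have k: "k \<in> Lp_fun p M"
      unfolding k_def using fA fB p by (intro Lp_fun_add Lp_fun_scale)
    have y: "y = ?cl k"
    proof -
      have "space M - A \<in> sets M"
        using assms(4) by auto
      then have "y = Lp_add p M (?cl (\<lambda>s. (r / R) *\<^sub>R ?fA s)) (?cl ?fB)"
        using False f fA assms(4) unfolding y_def g
        by (simp only: Lp_restrict_class Lp_scale_class if_False)
      then show ?thesis
        using Lp_add_class[OF Lp_fun_scale[OF fA] fB p] unfolding k_def by simp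
    qed
    show ?thesis
    proof (rule nearest_point_strict)
      \<comment> \<open>The part of \<open>k\<close> on \<open>A\<close> has norm exactly
        \<open>r\<close>: the candidate lies on the boundary of the cylinder.\<close>
      have "(if s \<in> A then k s else 0) = (r / R) *\<^sub>R ?fA s" for s
        by (simp add: k_def)
      moreover have "0 \<le> r / R"
        using \<open>r < R\<close> assms(6) by simp
      ultimately have "(\<integral>s. norm (if s \<in> A then k s else 0) powr p \<partial>M) = (r / R) powr p * R powr p"
        by (simp only: Lp_fun_integral_scale Rp)
      also have "\<dots> = r powr p"
        using \<open>r < R\<close> assms(6) by (simp flip: powr_mult)
      finally show "y \<in> ?C"
        using k p assms(4,6) by (simp add: y Lp_class_in_cylinder_iff powr_powr)
      \<comment> \<open>The difference vanishes off \<open>A\<close> and is a multiple of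
        \<open>f\<close> on \<open>A\<close>. The resulting distance \<open>R - r\<close> is
        precisely the bound under which \<open>nearest_in_cylinder_AE\<close> identifies a
        competitor.\<close>
      have "(\<integral>s. norm (f s - k s) powr p \<partial>M) = (\<integral>s. norm ((1 - r / R) *\<^sub>R ?fA s) powr p \<partial>M)"
        by (rule Bochner_Integration.integral_cong) (auto simp: k_def algebra_simps)
      also have "\<dots> = (1 - r / R) powr p * R powr p"
        using \<open>r < R\<close> assms(6) Rp by (subst Lp_fun_integral_scale) auto
      also have "\<dots> = ((1 - r / R) * R) powr p"
        by (rule powr_mult[symmetric])
      also have "(1 - r / R) * R = R - r"
        using \<open>r < R\<close> assms(6) by (simp add: field_simps)
      finally have gy: "?d g y = R - r"
        using f k p \<open>r < R\<close> by (simp add: g y Lp_dist_class powr_powr)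
      fix z assume z: "z \<in> ?C" "?d g z \<le> ?d g y"
      then obtain h where h: "h \<in> Lp_fun p M" "z = ?cl h"
        using in_C by blast
      have "(\<integral>s. norm (if s \<in> A then h s else 0) powr p \<partial>M) \<le> r powr p"
        using z(1) h assms(4,6) p by (simp add: Lp_class_in_cylinder_iff powr_inverse_le_iff Bochner_Integration.integral_nonneg)
      moreover have "(\<integral>s. norm (f s - h s) powr p \<partial>M) \<le> (R - r) powr p"
        using z(2) f h p \<open>r < R\<close> unfolding gy by (simp add: g Lp_dist_class powr_inverse_le_iff Bochner_Integration.integral_nonneg)
      ultimately have "AE s in M. h s = k s"
        unfolding k_def
        using nearest_in_cylinder_AE[OF assms(1,3,4) f h(1) assms(6) \<open>r < R\<close> Rp] by blast
      then show "z = y"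
        using h k by (simp add: y Lp_class_eq_iff)
    qed
  qed
  then have "(\<exists>!z. nearest_point ?d ?C g z) \<and> metric_projection ?d ?C g = y"
    by (simp add: metric_projection_def)
  then show ?thesis
    by (simp add: y_def R_def)
qed

end
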